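(* Consider the closed-loop system described in the context, in which at each time $k$ the input $u_k=c^\star_{0|k}$ is obtained by solving the MPC problem $(\mathrm{MPC}_k)$ with $\bar x_{0|k}=\hat x_k$ (the Kalman filter estimate) and the tightened sets $\bar{\mathcal{X}}_{\mathrm{RF},i}$, $\bar{\mathcal{U}}_{\mathrm{RF},i}$, $\bar{\mathcal{X}}_{f,\mathrm{RF}}$. For any $k\ge 0$, if $(\mathrm{MPC}_k)$ is feasible, then, with probability (conditional on $y_{0:k}$) no smaller than $1-p_f$, $(\mathrm{MPC}_{k+1})$ is feasible. More precisely, $(\mathrm{MPC}_{k+1})$ is feasible whenever the realized disturbance $n_k$ in $\hat x_{k+1}=A\hat x_k+Bu_k+n_k$ lies in $\mathcal{E}^n_{1-p_f}$.
   Context: System: $x_{k+1}=Ax_k+Bu_k+w_k$, $y_k=Cx_k+v_k$, with $w_k\sim\mathcal{N}(0,Q)$, $v_k\sim\mathcal{N}(0,R)$ i.i.d. and mutually independent, $x_0\sim\mathcal{N}(\mu_0,\Sigma_0)$; $(A,B)$ controllable, $(A,C)$ observable. Kalman filter: $\hat x^-_{k+1}=A\hat x_k+Bu_k$, $\hat x_{k+1}=\hat x^-_{k+1}+L_{k+1}(y_{k+1}-C\hat x^-_{k+1})$, $\hat x_0^-=\mu_0$, $P_0^-=\Sigma_0$, $P^-_{k+1}=AP_kA^\top+Q$, $P_{k+1}=(I-L_{k+1}C)P^-_{k+1}$, $L_{k+1}=P^-_{k+1}C^\top(CP^-_{k+1}C^\top+R)^{-1}$. Then $\hat x_{k+1}=A\hat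 x_k+Bu_k+n_k$ with $n_k=L_{k+1}CAe_k+L_{k+1}Cw_k+L_{k+1}v_{k+1}$, $e_k=x_k-\hat x_k$, and conditionally on $y_{0:k}$, $n_k\sim\mathcal{N}(0,\Phi_k)$, $\Phi_k=L_{k+1}(C(AP_kA^\top+Q)C^\top+R)L_{k+1}^\top$; also $e_k\mid y_{0:k}\sim\mathcal{N}(0,P_k)$. Constraints: $\mathcal{X}\subseteq\mathbb{R}^{n_x}$ a convex polyhedron, $\mathcal{U}$ a polytope, probabilities $p_x,p_f\in(0,1)$. $\mathcal{E}^e_{1-p_x}$ and $\mathcal{E}^n_{1-p_f}$ are compact polytopes containing the origin in their interior with $\mathbb{P}(e_k\in\mathcal{E}^e_{1-p_x}\mid y_{0:k})\ge 1-p_x$ and $\mathbb{P}(n_k\in\mathcal{E}^n_{1-p_f}\mid y_{0:k})\ge 1-p_f$ for all $k$. $K$ is a gain with $A_{\mathrm{cl}}:=A+BK$ Schur. $\oplus$ is Minkowski sum, $\mathcal{X}\ominus\mathcal{Y}=\{x: x+y\in\mathcal{X}\ \forall y\in\mathcal{Y}\}$ is the Pontryagin difference, $\bigoplus_{q=0}^{-1}(\cdot)=\{0\}$. Tightened sets: $\hat{\mathcal{X}}=\mathcal{X}\ominus\mathcal{E}^e_{1-p_x}$; $\bar{\mathcal{X}}_{\mathrm{RF},i}=\hat{\mathcal{X}}\ominus\bigoplus_{q=0}^{i-1}A_{\mathrm{cl}}^q\mathcal{E}^n_{1-p_f}$ and $\bar{\mathcal{U}}_{\mathrm{RF},i}=\mathcal{U}\ominus\bigoplus_{q=0}^{i-1}KA_{\mathrm{cl}}^q\mathcal{E}^n_{1-p_f}$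 for $i=0,\dots,N-1$; $\hat{\mathcal{X}}_f\subseteq\hat{\mathcal{X}}$ is a robust positive invariant set for $x^+=A_{\mathrm{cl}}x+n$, $n\in\mathcal{E}^n_{1-p_f}$ (i.e. $x\in\hat{\mathcal{X}}_f\Rightarrow A_{\mathrm{cl}}x+n\in\hat{\mathcal{X}}_f$ for all $n\in\mathcal{E}^n_{1-p_f}$) with $Kx\in\mathcal{U}$ for all $x\in\hat{\mathcal{X}}_f$; $\bar{\mathcal{X}}_{f,\mathrm{RF}}=\hat{\mathcal{X}}_f\ominus\bigoplus_{q=0}^{N-1}A_{\mathrm{cl}}^q\mathcal{E}^n_{1-p_f}$. MPC problem $(\mathrm{MPC}_k)$ with horizon $N\ge1$: minimize $\sum_{i=0}^{N-1}\ell(\bar x_{i|k},c_{i|k})+O(\bar x_{N|k})$ over $c_{0|k},\dots,c_{N-1|k}$ subject to $\bar x_{i+1|k}=A\bar x_{i|k}+Bc_{i|k}$, $\bar x_{0|k}=\hat x_k$, $\bar x_{i|k}\in\bar{\mathcal{X}}_{\mathrm{RF},i}$, $c_{i|k}\in\bar{\mathcal{U}}_{\mathrm{RF},i}$ for $i=0,\dots,N-1$, and $\bar x_{N|k}\in\bar{\mathcal{X}}_{f,\mathrm{RF}}$; $\ell$ and $O$ are given cost functions. "Feasible" means the constraint set is nonempty; the applied input is $u_k=c^\star_{0|k}$ from an optimal solution. *)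

theory Defs
  imports "HOL-Analysis.Analysis" "HOL-Probability.Probability"
begin

(* matrix power *)
fun mpow :: "('a::semiring_1)^'n^'n \<Rightarrow> nat \<Rightarrow> 'a^'n^'n" where
  "mpow A 0 = mat 1"
| "mpow A (Suc k) = A ** mpow A k"

(* Minkowski sum and Pontryagin difference *)
definition msum :: "'a::ab_group_add set \<Rightarrow> 'a set \<Rightarrow> 'a set" where
  "msum X Y = {x + y | x y. x \<in> X \<and> y \<in> Y}"

definition pdiff :: "'a::ab_group_add set \<Rightarrow> 'a set \<Rightarrow> 'a set" where
  "pdiff X Y = {x. \<forall>y\<in>Y. x + y \<in> X}"

(* iterated Minkowski sum  (+)_{q=0}^{i-1} F q, equal to {0} for i = 0 *)
fun bigmsum :: "(nat \<Rightarrow> 'a::ab_group_add set) \<Rightarrow> nat \<Rightarrow> 'a set" where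
  "bigmsum F 0 = {0}"
| "bigmsum F (Suc i) = msum (bigmsum F i) (F i)"

(* Schur stability: all (complex) eigenvalues have modulus < 1 *)
definition schur :: "real^'n^'n \<Rightarrow> bool" where
  "schur A \<longleftrightarrow> (\<forall>(v::complex^'n) (lam::complex).
      v \<noteq> 0 \<and> (\<chi> i j. complex_of_real (A$i$j)) *v v = lam *s v \<longrightarrow> cmod lam < 1)"

(* controllability of (A,B): rank [B, AB, ..., A^(n-1) B] = n *)
definition controllable :: "real^'n^'n \<Rightarrow> real^'m^'n \<Rightarrow> bool" where
  "controllable A B \<longleftrightarrow>
     span {mpow A i *v (B *v u) | i u. i < CARD('n)} = UNIV"

(* observability of (A,C): rank [C; CA; ...; CA^(n-1)] = n *)
definition observable :: "real^'n^'n \<Rightarrow> real^'n^'p \<Rightarrow> bool" where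
  "observable A C \<longleftrightarrow>
     (\<forall>x. (\<forall>i < CARD('n). C *v (mpow A i *v x) = 0) \<longrightarrow> x = 0)"

(* nominal prediction  xbar_{i+1} = A xbar_i + B c_i, xbar_0 = x0 *)
fun traj :: "real^'n^'n \<Rightarrow> real^'m^'n \<Rightarrow> real^'n \<Rightarrow> (nat \<Rightarrow> real^'m) \<Rightarrow> nat \<Rightarrow> real^'n" where
  "traj A B x0 c 0 = x0"
| "traj A B x0 c (Suc i) = A *v traj A B x0 c i + B *v c i"

(* tightened sets *)
definition Xhat :: "(real^'n) set \<Rightarrow> (real^'n) set \<Rightarrow> (real^'n) set" where
  "Xhat X Ee = pdiff X Ee"

definition XRF :: "real^'n^'n \<Rightarrow> (real^'n) set \<Rightarrow> (real^'n) set \<Rightarrow> nat \<Rightarrow> (real^'n) set" where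
  "XRF Acl Xh En i = pdiff Xh (bigmsum (\<lambda>q. (\<lambda>e. mpow Acl q *v e) ` En) i)"

definition URF :: "real^'n^'n \<Rightarrow> real^'n^'m \<Rightarrow> (real^'m) set \<Rightarrow> (real^'n) set \<Rightarrow> nat \<Rightarrow> (real^'m) set" where
  "URF Acl K U En i = pdiff U (bigmsum (\<lambda>q. (\<lambda>e. K *v (mpow Acl q *v e)) ` En) i)"

definition XfRF :: "real^'n^'n \<Rightarrow> (real^'n) set \<Rightarrow> (real^'n) set \<Rightarrow> nat \<Rightarrow> (real^'n) set" where
  "XfRF Acl Xf En N = pdiff Xf (bigmsum (\<lambda>q. (\<lambda>e. mpow Acl q *v e) ` En) N)"

(* the constraint set of (MPC) at initial state x0 is satisfied by the input sequence c *)
definition mpc_admissible ::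
  "real^'n^'n \<Rightarrow> real^'m^'n \<Rightarrow> real^'n^'m \<Rightarrow> nat \<Rightarrow> (real^'n) set \<Rightarrow> (real^'m) set
   \<Rightarrow> (real^'n) set \<Rightarrow> (real^'n) set \<Rightarrow> real^'n \<Rightarrow> (nat \<Rightarrow> real^'m) \<Rightarrow> bool" where
  "mpc_admissible A B K N Xh U En Xf x0 c \<longleftrightarrow>
     (\<forall>i<N. traj A B x0 c i \<in> XRF (A + B ** K) Xh En i
            \<and> c i \<in> URF (A + B ** K) K U En i)
     \<and> traj A B x0 c N \<in> XfRF (A + B ** K) Xf En N"

(* (MPC) is feasible at x0: its constraint set is nonempty *)
definition mpc_feasible ::
  "real^'n^'n \<Rightarrow> real^'m^'n \<Rightarrow> real^'n^'m \<Rightarrow> nat \<Rightarrow> (real^'n) set \<Rightarrow> (real^'m) set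
   \<Rightarrow> (real^'n) set \<Rightarrow> (real^'n) set \<Rightarrow> real^'n \<Rightarrow> bool" where
  "mpc_feasible A B K N Xh U En Xf x0 \<longleftrightarrow> (\<exists>c. mpc_admissible A B K N Xh U En Xf x0 c)"

definition mpc_cost ::
  "real^'n^'n \<Rightarrow> real^'m^'n \<Rightarrow> nat \<Rightarrow> (real^'n \<Rightarrow> real^'m \<Rightarrow> real) \<Rightarrow> (real^'n \<Rightarrow> real)
   \<Rightarrow> real^'n \<Rightarrow> (nat \<Rightarrow> real^'m) \<Rightarrow> real" where
  "mpc_cost A B N ell Vf x0 c = (\<Sum>i<N. ell (traj A B x0 c i) (c i)) + Vf (traj A B x0 c N)"

(* c is an optimal solution of (MPC) at x0 *)
definition mpc_optimal ::
  "real^'n^'n \<Rightarrow> real^'m^'n \<Rightarrow> real^'n^'m \<Rightarrow> nat \<Rightarrow> (real^'n) set \<Rightarrow> (real^'m) set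
   \<Rightarrow> (real^'n) set \<Rightarrow> (real^'n) set \<Rightarrow> (real^'n \<Rightarrow> real^'m \<Rightarrow> real) \<Rightarrow> (real^'n \<Rightarrow> real)
   \<Rightarrow> real^'n \<Rightarrow> (nat \<Rightarrow> real^'m) \<Rightarrow> bool" where
  "mpc_optimal A B K N Xh U En Xf ell Vf x0 c \<longleftrightarrow>
     mpc_admissible A B K N Xh U En Xf x0 c \<and>
     (\<forall>c'. mpc_admissible A B K N Xh U En Xf x0 c' \<longrightarrow>
            mpc_cost A B N ell Vf x0 c \<le> mpc_cost A B N ell Vf x0 c')"

end

theory Submission
  imports Defs
begin

text \<open>Recursive feasibility follows from the usual shifted candidate. Its first N-1 inputs are the
tail of the optimal sequence plus the feedback correction K A_cl^i n_k, which keeps the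
perturbed nominal trajectory equal to the old one plus A_cl^i n_k. Its last input is
K applied to the terminal prediction. Each tightened set is the previous one shrunk
by exactly the propagated disturbance, so the shift consumes one summand of every
Minkowski sum. Robust invariance of X_f absorbs the new summand at the end of the
horizon. The probability bound is that of the measurable event n_k in E^n.\<close>

lemma msum_zero_left [simp]: "msum {0} X = X"
  by (auto simp: msum_def)

lemma msum_zero_right [simp]: "msum X {0} = X"
  by (auto simp: msum_def)

lemma msum_assoc: "msum (msum X Y) Z = msum X (msum Y Z)"
  unfolding msum_def by (auto simp: add.assoc) (metis, metis add.assoc)

lemma bigmsum_Suc_shift: "bigmsum F (Suc i) = msum (F 0) (bigmsum (\<lambda>q. F (Suc q)) i)"
  by (induction i) (simp_all add: msum_assoc)

lemma image_msum_additive: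
  assumes "Modules.additive f"
  shows "f ` msum X Y = msum (f ` X) (f ` Y)"
  unfolding msum_def by (auto simp: image_iff) (metis Modules.additive.add[OF assms])+

lemma bigmsum_image_additive:
  assumes "Modules.additive f"
  shows "bigmsum (\<lambda>q. f ` F q) i = f ` bigmsum F i"
  by (induction i) (simp_all add: Modules.additive.zero[OF assms] image_msum_additive[OF assms])

lemma pdiff_msum_shift: "x \<in> pdiff X (msum Y Z) \<Longrightarrow> z \<in> Z \<Longrightarrow> x + z \<in> pdiff X Y"
  unfolding pdiff_def msum_def by (auto simp: add.assoc) (metis add.commute)

lemma pdiff_mono: "X \<subseteq> X' \<Longrightarrow> pdiff X Y \<subseteq> pdiff X' Y"
  unfolding pdiff_def by auto

lemma additive_image_mem_pdiff:
  assumes "Modules.additive f" "x \<in> pdiff X W" "f ` X \<subseteq> U"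
  shows "f x \<in> pdiff U (f ` W)"
  using assms unfolding pdiff_def by (auto simp: Modules.additive.add[OF assms(1), symmetric])

lemma robust_invariant_mem_pdiff:
  assumes "Modules.additive f" and inv: "\<And>x e. x \<in> X \<Longrightarrow> e \<in> E \<Longrightarrow> f x + e \<in> X"
    and "x \<in> pdiff X W"
  shows "f x \<in> pdiff X (msum E (f ` W))"
  unfolding pdiff_def msum_def
proof safe
  fix e w assume "e \<in> E" "w \<in> W"
  then have "f (x + w) + e \<in> X" using assms(3) inv unfolding pdiff_def by blast
  then show "f x + (e + f w) \<in> X" by (simp add: Modules.additive.add[OF assms(1)] add_ac)
qed

lemma additive_matrix_vector_mult: "Modules.additive ((*v) A)"
  by (simp add: Modules.additive_def matrix_vector_right_distrib)

lemma bigmsum_mpow_Suc: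
  "bigmsum (\<lambda>q. (\<lambda>e. mpow A q *v e) ` E) (Suc i)
     = msum E ((*v) A ` bigmsum (\<lambda>q. (\<lambda>e. mpow A q *v e) ` E) i)"
proof -
  have "(\<lambda>e. mpow A (Suc q) *v e) ` E = (*v) A ` (\<lambda>e. mpow A q *v e) ` E" for q
    by (simp add: image_image matrix_vector_mul_assoc)
  then show ?thesis
    by (simp only: bigmsum_Suc_shift bigmsum_image_additive[OF additive_matrix_vector_mult])
       simp
qed

lemma bigmsum_gain_mpow:
  "bigmsum (\<lambda>q. (\<lambda>e. K *v (mpow A q *v e)) ` E) i
     = (*v) K ` bigmsum (\<lambda>q. (\<lambda>e. mpow A q *v e) ` E) i"
  by (simp add: image_image bigmsum_image_additive[OF additive_matrix_vector_mult, symmetric])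

lemma traj_shifted_candidate:
  assumes "\<forall>j<i. c' j = c (Suc j) + K *v (mpow (A + B ** K) j *v v)"
  shows "traj A B (A *v x + B *v c 0 + v) c' i = traj A B x c (Suc i) + mpow (A + B ** K) i *v v"
  using assms
proof (induction i)
  case (Suc i)
  then show ?case
    by (simp add: matrix_vector_right_distrib matrix_vector_mult_add_rdistrib
        matrix_vector_mul_assoc[symmetric] add_ac)
qed simp

lemma XRF_Suc_shift:
  "x \<in> XRF Acl Xh En (Suc i) \<Longrightarrow> v \<in> En \<Longrightarrow> x + mpow Acl i *v v \<in> XRF Acl Xh En i"
  unfolding XRF_def by (auto intro: pdiff_msum_shift)

lemma URF_Suc_shift:
  "u \<in> URF Acl K U En (Suc i) \<Longrightarrow> v \<in> En \<Longrightarrow> u + K *v (mpow Acl i *v v) \<in> URF Acl K U En i"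
  unfolding URF_def by (auto intro: pdiff_msum_shift)

lemma XfRF_Suc_shift:
  "x \<in> XfRF Acl Xf En (Suc i) \<Longrightarrow> v \<in> En \<Longrightarrow> x + mpow Acl i *v v \<in> XfRF Acl Xf En i"
  unfolding XfRF_def by (auto intro: pdiff_msum_shift)

lemma XfRF_subset_XRF: "Xf \<subseteq> Xh \<Longrightarrow> XfRF Acl Xf En i \<subseteq> XRF Acl Xh En i"
  unfolding XfRF_def XRF_def by (rule pdiff_mono)

lemma XfRF_feedback_in_URF:
  assumes "\<And>x. x \<in> Xf \<Longrightarrow> K *v x \<in> U" and "x \<in> XfRF Acl Xf En i"
  shows "K *v x \<in> URF Acl K U En i"
  using assms unfolding XfRF_def URF_def bigmsum_gain_mpow
  by (intro additive_image_mem_pdiff[OF additive_matrix_vector_mult]) auto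

lemma XfRF_closed_loop_Suc:
  assumes "\<And>x e. x \<in> Xf \<Longrightarrow> e \<in> En \<Longrightarrow> Acl *v x + e \<in> Xf" and "x \<in> XfRF Acl Xf En i"
  shows "Acl *v x \<in> XfRF Acl Xf En (Suc i)"
  using robust_invariant_mem_pdiff[OF additive_matrix_vector_mult] assms
  unfolding XfRF_def bigmsum_mpow_Suc by blast

lemma mpc_feasible_successor:
  fixes A :: "real^'n^'n" and B :: "real^'m^'n" and K :: "real^'n^'m"
  assumes Xf_sub: "Xf \<subseteq> Xh"
    and Xf_rpi: "\<And>x e. x \<in> Xf \<Longrightarrow> e \<in> En \<Longrightarrow> (A + B ** K) *v x + e \<in> Xf"
    and Xf_U: "\<And>x. x \<in> Xf \<Longrightarrow> K *v x \<in> U"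
    and N: "N \<ge> 1" and adm: "mpc_admissible A B K N Xh U En Xf x c" and v: "v \<in> En"
  shows "mpc_feasible A B K N Xh U En Xf (A *v x + B *v c 0 + v)"
proof -
  define Acl where "Acl = A + B ** K"
  define t where "t = traj A B x c N + mpow Acl (N - 1) *v v"
  define c' where "c' i = (if i < N - 1 then c (Suc i) + K *v (mpow Acl i *v v) else K *v t)" for i
  define x' where "x' = A *v x + B *v c 0 + v"
  have N_Suc: "N = Suc (N - 1)" using N by simp
  have traj': "traj A B x' c' i = traj A B x c (Suc i) + mpow Acl i *v v" if "i \<le> N - 1" for i
    unfolding x'_def Acl_def using that
    by (intro traj_shifted_candidate) (auto simp: c'_def Acl_def)
  have X_old: "traj A B x c i \<in> XRF Acl Xh En i" and U_old: "c i \<in> URF Acl K U En i"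
    if "i < N" for i
    using adm that by (auto simp: mpc_admissible_def Acl_def)
  have "traj A B x c (Suc (N - 1)) \<in> XfRF Acl Xf En (Suc (N - 1))"
    using adm N_Suc by (simp add: mpc_admissible_def Acl_def)
  then have t_Xf: "t \<in> XfRF Acl Xf En (N - 1)"
    unfolding t_def using XfRF_Suc_shift[OF _ v] N_Suc by simp
  have "traj A B x' c' i \<in> XRF Acl Xh En i \<and> c' i \<in> URF Acl K U En i" if "i < N" for i
  proof (cases "i < N - 1")
    case True
    then show ?thesis
      using XRF_Suc_shift[OF X_old v] URF_Suc_shift[OF U_old v] traj'[of i] by (simp add: c'_def)
  next
    case False
    then have i: "i = N - 1" using that by simp
    have "traj A B x' c' i = t" using traj'[of i] i N_Suc by (simp add: t_def)
    then show ?thesis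
      using i t_Xf XfRF_subset_XRF[OF Xf_sub] XfRF_feedback_in_URF[OF Xf_U]
      by (auto simp: c'_def)
  qed
  moreover have "traj A B x' c' N \<in> XfRF Acl Xf En N"
  proof -
    have "traj A B x' c' (N - 1) = t"
      using traj'[of "N - 1"] N by (simp add: t_def)
    then have "traj A B x' c' N = Acl *v t"
      by (subst N_Suc) (simp add: c'_def Acl_def matrix_vector_mult_add_rdistrib
          matrix_vector_mul_assoc)
    also have "\<dots> \<in> XfRF Acl Xf En (Suc (N - 1))"
      using Xf_rpi t_Xf unfolding Acl_def by (rule XfRF_closed_loop_Suc)
    finally show ?thesis using N_Suc by simp
  qed
  ultimately have "mpc_admissible A B K N Xh U En Xf x' c'"
    by (simp add: mpc_admissible_def Acl_def)
  then show ?thesis by (auto simp: mpc_feasible_def x'_def)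
qed

theorem theorem1:
  fixes A :: "real^'n^'n" and B :: "real^'m^'n" and C :: "real^'n^'p"
    and K :: "real^'n^'m"
    and X Ee En Xf :: "(real^'n) set" and U :: "(real^'m) set"
    and px pf :: real and N :: nat
    and ell :: "real^'n \<Rightarrow> real^'m \<Rightarrow> real" and Vf :: "real^'n \<Rightarrow> real"
    and xhat :: "real^'n" and c :: "nat \<Rightarrow> real^'m"
    and M :: "'w measure" and n :: "'w \<Rightarrow> real^'n"
  assumes ctrb: "controllable A B" and obsv: "observable A C"
    and X_poly: "polyhedron X" and U_poly: "polytope U"
    and px: "0 < px" "px < 1" and pf: "0 < pf" "pf < 1"
    and Ee: "polytope Ee" "compact Ee" "0 \<in> interior Ee"
    and En: "polytope En" "compact En" "0 \<in> interior En"
    and schur: "schur (A + B ** K)"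
    and Xf_sub: "Xf \<subseteq> Xhat X Ee"
    and Xf_rpi: "\<And>x v. x \<in> Xf \<Longrightarrow> v \<in> En \<Longrightarrow> (A + B ** K) *v x + v \<in> Xf"
    and Xf_U: "\<And>x. x \<in> Xf \<Longrightarrow> K *v x \<in> U"
    and N: "N \<ge> 1"
    and opt: "mpc_optimal A B K N (Xhat X Ee) U En Xf ell Vf xhat c"
    and M: "prob_space M" and n_meas: "n \<in> borel_measurable M"
    and n_prob: "measure M {\<omega> \<in> space M. n \<omega> \<in> En} \<ge> 1 - pf"
  shows "(\<forall>v \<in> En. mpc_feasible A B K N (Xhat X Ee) U En Xf (A *v xhat + B *v c 0 + v))
     \<and> (\<exists>S \<in> sets M. S \<subseteq> {\<omega> \<in> space M.
            mpc_feasible A B K N (Xhat X Ee) U En Xf (A *v xhat + B *v c 0 + n \<omega>)}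
          \<and> measure M S \<ge> 1 - pf)"
proof -
  have "mpc_admissible A B K N (Xhat X Ee) U En Xf xhat c"
    using opt by (simp add: mpc_optimal_def)
  then have feasible: "\<forall>v \<in> En. mpc_feasible A B K N (Xhat X Ee) U En Xf (A *v xhat + B *v c 0 + v)"
    using mpc_feasible_successor[OF Xf_sub Xf_rpi Xf_U N] by blast
  define S where "S = {\<omega> \<in> space M. n \<omega> \<in> En}"
  have "En \<in> sets borel"
    using En(2) by (simp add: compact_imp_closed)
  then have "S \<in> sets M"
    unfolding S_def using measurable_sets[OF n_meas] by (simp add: vimage_def Int_def conj_commute)
  moreover have "S \<subseteq> {\<omega> \<in> space M.
      mpc_feasible A B K N (Xhat X Ee) U En Xf (A *v xhat + B *v c 0 + n \<omega>)}"
    using feasible by (auto simp: S_def)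
  ultimately show ?thesis
    using feasible n_prob unfolding S_def by blast
qed

end
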